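(* Let $\mu>0$ and let $F:\mathbb R^n\to\mathbb R$ be a $C^2$ function that is $\mu$-strongly convex. Consider the heavy-ball iteration $x_{k+1}=x_k+\beta_{\rm hb}(x_k-x_{k-1})-s\nabla F(x_k)$ with Polyak's choice $\beta_{\rm hb}=(1-\sqrt{\mu s})^2$, and its equivalent template $X_{k+1}=\Phi_{\rm HB}(X_k,\sqrt{s})$ with $X_k=(x_k,v_k)$, $v_k=(x_k-x_{k-1})/\sqrt{s}$ and, for $X=(x,v)\in\mathbb R^n\times\mathbb R^n$, $$\Phi_{\rm HB}(X,\sqrt{s})=\begin{bmatrix}x+\sqrt{s}\left[\beta_{\rm hb}v-\sqrt{s}\nabla F(x)\right]\\ \beta_{\rm hb}v-\sqrt{s}\nabla F(x)\end{bmatrix}.$$ Then the $O(\sqrt{s})$-resolution ODE with respect to this template is $$\begin{bmatrix} x \\ v \end{bmatrix}'=\begin{bmatrix}v\\ -2\sqrt{\mu}\,v-\nabla F(x)\end{bmatrix}+\frac{\sqrt{s}}{2}\begin{bmatrix}-2\sqrt{\mu}\,v-\nabla F(x)\\ -2\mu v+\nabla^2F(x)v-2\sqrt{\mu}\,\nabla F(x)\end{bmatrix}.$$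
   Context: Definition: given a template $X^+=\Phi(X,\sqrt{s})$ with $\Phi(X,0)=X$ for all $X$, an ODE $X'(t)=\Gamma_0(X(t))+\sqrt{s}\,\Gamma_1(X(t))$, $X(0)=X$, with $\Gamma_0,\Gamma_1$ independent of $s$, is the $O(\sqrt{s})$-resolution ODE with respect to the template if for every $X$ its solution satisfies $\|X(\sqrt{s})-X^+\|=o\big((\sqrt{s})^{2}\big)=o(s)$ as $s\to0^+$. Here $\beta_{\rm hb}$ is regarded as a function of $\sqrt{s}$. *)

theory Defs
  imports "HOL-Analysis.Analysis" "HOL-Library.Landau_Symbols"
begin

definition grad :: "(real ^ 'n \<Rightarrow> real) \<Rightarrow> real ^ 'n \<Rightarrow> real ^ 'n" where
  "grad F x = (THE g. GDERIV F x :> g)"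

definition hessian :: "(real ^ 'n \<Rightarrow> real) \<Rightarrow> real ^ 'n \<Rightarrow> real ^ 'n ^ 'n" where
  "hessian F x = jacobian (grad F) (at x)"

definition C2 :: "(real ^ 'n \<Rightarrow> real) \<Rightarrow> bool" where
  "C2 F \<longleftrightarrow>
     (\<forall>x. F differentiable (at x)) \<and>
     (\<forall>x. grad F differentiable (at x)) \<and>
     continuous_on UNIV (hessian F)"

definition strongly_convex :: "real \<Rightarrow> (real ^ 'n \<Rightarrow> real) \<Rightarrow> bool" where
  "strongly_convex \<mu> F \<longleftrightarrow> convex_on UNIV (\<lambda>x. F x - \<mu> / 2 * (norm x)\<^sup>2)"

definition ode_solution ::
    "('a::real_normed_vector \<Rightarrow> 'a) \<Rightarrow> 'a \<Rightarrow> real \<Rightarrow> (real \<Rightarrow> 'a) \<Rightarrow> bool" where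
  "ode_solution f X T Y \<longleftrightarrow>
     Y 0 = X \<and> (\<forall>t\<in>{0..T}. (Y has_vector_derivative f (Y t)) (at t within {0..T}))"

text \<open>
  Templates take the square root of the step size as their second argument. The phrase
  ``its solution'' is read without presupposing global existence or uniqueness for the ODE
  (for a \<open>C\<^sup>2\<close> objective the right-hand side is in general only continuous): for all
  sufficiently small \<open>s > 0\<close> a solution on \<open>[0, sqrt s]\<close> exists, and the error bound
  holds for every choice of solutions \<open>Y s\<close>.
\<close>

definition sqrt_resolution_ode ::
    "('a::real_normed_vector \<Rightarrow> real \<Rightarrow> 'a) \<Rightarrow> ('a \<Rightarrow> 'a) \<Rightarrow> ('a \<Rightarrow> 'a) \<Rightarrow> bool" where
  "sqrt_resolution_ode \<Phi> \<Gamma>0 \<Gamma>1 \<longleftrightarrow>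
     (\<forall>X. \<Phi> X 0 = X) \<and>
     (\<forall>X.
        (\<forall>\<^sub>F s in at_right 0.
           \<exists>Y. ode_solution (\<lambda>Z. \<Gamma>0 Z + sqrt s *\<^sub>R \<Gamma>1 Z) X (sqrt s) Y) \<and>
        (\<forall>Y. (\<forall>\<^sub>F s in at_right 0.
                ode_solution (\<lambda>Z. \<Gamma>0 Z + sqrt s *\<^sub>R \<Gamma>1 Z) X (sqrt s) (Y s)) \<longrightarrow>
             (\<lambda>s. norm (Y s (sqrt s) - \<Phi> X (sqrt s))) \<in> o[at_right 0](\<lambda>s. s)))"

text \<open>The definite article: uniqueness is among ODEs with continuous right-hand sides.\<close>

definition the_sqrt_resolution_ode ::
    "('a::real_normed_vector \<Rightarrow> real \<Rightarrow> 'a) \<Rightarrow> ('a \<Rightarrow> 'a) \<Rightarrow> ('a \<Rightarrow> 'a) \<Rightarrow> bool" where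
  "the_sqrt_resolution_ode \<Phi> \<Gamma>0 \<Gamma>1 \<longleftrightarrow>
     sqrt_resolution_ode \<Phi> \<Gamma>0 \<Gamma>1 \<and>
     (\<forall>G0 G1. continuous_on UNIV G0 \<and> continuous_on UNIV G1 \<and>
        sqrt_resolution_ode \<Phi> G0 G1 \<longrightarrow> G0 = \<Gamma>0 \<and> G1 = \<Gamma>1)"

text \<open>
  Polyak's coefficient as a function of \<open>h = sqrt s\<close>; for \<open>s \<ge> 0\<close>,
  \<open>sqrt \<mu> * sqrt s = sqrt (\<mu> * s)\<close>.
\<close>

definition polyak_beta :: "real \<Rightarrow> real \<Rightarrow> real" where
  "polyak_beta \<mu> h = (1 - sqrt \<mu> * h)\<^sup>2"

definition hb_template ::
    "real \<Rightarrow> (real ^ 'n \<Rightarrow> real) \<Rightarrow> (real ^ 'n) \<times> (real ^ 'n) \<Rightarrow> real \<Rightarrow> (real ^ 'n) \<times> (real ^ 'n)" where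
  "hb_template \<mu> F = (\<lambda>(x, v) h.
     (x + h *\<^sub>R (polyak_beta \<mu> h *\<^sub>R v - h *\<^sub>R grad F x),
      polyak_beta \<mu> h *\<^sub>R v - h *\<^sub>R grad F x))"

text \<open>
  The equivalence of the iteration and the template, with the sequence indexed so that \<open>x 0\<close> is
  the extra initial point \<open>x\<^sub>-\<^sub>1\<close>. For \<open>h = sqrt s\<close>, \<open>h\<^sup>2 = s\<close>.
\<close>

definition heavy_ball :: "real \<Rightarrow> (real ^ 'n \<Rightarrow> real) \<Rightarrow> real \<Rightarrow> (nat \<Rightarrow> real ^ 'n) \<Rightarrow> bool" where
  "heavy_ball \<mu> F s x \<longleftrightarrow>
     (\<forall>k. x (k + 2) =
        x (k + 1) + (1 - sqrt (\<mu> * s))\<^sup>2 *\<^sub>R (x (k + 1) - x k) - s *\<^sub>R grad F (x (k + 1)))"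

lemma heavy_ball_iff_hb_template:
  fixes F :: "real ^ 'n \<Rightarrow> real" and x :: "nat \<Rightarrow> real ^ 'n"
  assumes "s > 0"
  defines "X \<equiv> \<lambda>k. (x (k + 1), (x (k + 1) - x k) /\<^sub>R sqrt s)"
  shows "heavy_ball \<mu> F s x \<longleftrightarrow> (\<forall>k. X (k + 1) = hb_template \<mu> F (X k) (sqrt s))"
proof -
  have "x (k + 2) =
        x (k + 1) + (1 - sqrt (\<mu> * s))\<^sup>2 *\<^sub>R (x (k + 1) - x k) - s *\<^sub>R grad F (x (k + 1))
      \<longleftrightarrow> X (k + 1) = hb_template \<mu> F (X k) (sqrt s)" for k
  proof -
    define h where "h = sqrt s"
    have h: "h > 0" "s = h * h" using assms(1) by (auto simp: h_def)
    have b: "(1 - sqrt (\<mu> * s))\<^sup>2 = polyak_beta \<mu> h"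
      by (simp add: polyak_beta_def h_def real_sqrt_mult)
    define b where "b = polyak_beta \<mu> h"
    define w where "w = b *\<^sub>R ((x (k + 1) - x k) /\<^sub>R h) - h *\<^sub>R grad F (x (k + 1))"
    have hw: "h *\<^sub>R w = b *\<^sub>R (x (k + 1) - x k) - s *\<^sub>R grad F (x (k + 1))"
      using h(1) by (simp add: w_def h(2) algebra_simps)
    have "X (k + 1) = hb_template \<mu> F (X k) (sqrt s) \<longleftrightarrow>
        x (k + 2) = x (k + 1) + h *\<^sub>R w \<and> (x (k + 2) - x (k + 1)) /\<^sub>R h = w"
      by (simp add: X_def hb_template_def w_def b_def flip: h_def)
    also have "\<dots> \<longleftrightarrow> x (k + 2) = x (k + 1) + h *\<^sub>R w"
      using h(1) by auto
    finally show ?thesis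
      unfolding hw b b_def by (simp add: algebra_simps)
  qed
  then show ?thesis
    unfolding heavy_ball_def by simp
qed

end

theory Submission
  imports Defs "HOL-Complex_Analysis.Great_Picard"
begin

text \<open>
  Write \<open>h = sqrt s\<close>. A solution of \<open>Y' = A(Y) + h B(Y)\<close>, \<open>Y(0) = X\<close>, stays within \<open>O(h)\<close> of \<open>X\<close> on
  \<open>[0, h]\<close>. Since \<open>A\<close> is differentiable and \<open>B\<close> continuous at \<open>X\<close>, its velocity at time \<open>t\<close> is
  \<open>A(X) + h B(X) + t A'(X)A(X) + o(h)\<close> uniformly in \<open>t\<close>, and the mean value inequality gives
  \<open>Y(h) = X + h A(X) + h\<^sup>2 (B(X) + A'(X)A(X)/2) + o(h\<^sup>2)\<close>. The claim follows by comparing with the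
  expansion of the template, which for heavy ball has remainder exactly \<open>(\<mu> h\<^sup>3 v, 0)\<close>. A
  competing pair with merely continuous \<open>G0\<close> must first satisfy \<open>G0 = A\<close> by the first order terms;
  then \<open>G0\<close> is differentiable and the second order terms give \<open>G1 = B\<close>. As \<open>B\<close> is only continuous,
  solutions are supplied by Peano's theorem.
\<close>

section \<open>Peano's existence theorem\<close>

text \<open>
  In Tonelli's delayed equation, the value at \<open>t\<close> depends on the past up to \<open>t - d\<close> only. Hence the
  fixed point iteration from a constant is stationary on \<open>[0, k d]\<close> after \<open>k\<close> steps, and no
  Lipschitz condition is needed.
\<close>

definition tonelli_step ::
    "('a::euclidean_space \<Rightarrow> 'a) \<Rightarrow> 'a \<Rightarrow> real \<Rightarrow> (real \<Rightarrow> 'a) \<Rightarrow> real \<Rightarrow> 'a" where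
  "tonelli_step g X d Y t = X + integral {0..t} (\<lambda>\<tau>. g (Y (max 0 (\<tau> - d))))"

text \<open>Clamping the delayed time at 0 keeps the argument of \<open>Y\<close> in
  \<open>{0..}\<close>, where \<open>Y\<close> is known to be continuous, for every
  \<open>\<tau>\<close> in \<open>S\<close>.\<close>

lemma continuous_on_delayed:
  fixes Y :: "real \<Rightarrow> 'a::euclidean_space"
  assumes "continuous_on UNIV g" "continuous_on {0..} Y"
  shows "continuous_on S (\<lambda>\<tau>. g (Y (max 0 (\<tau> - d))))"
  by (intro continuous_on_compose2[OF assms(1)] continuous_on_compose2[OF assms(2)]
      continuous_intros) auto

text \<open>The constant \<open>M\<close> depends neither on \<open>d\<close> nor on
  \<open>Y\<close>. This uniformity later makes the delayed solutions equicontinuous.\<close>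

lemma tonelli_step_lipschitz:
  fixes g :: "'a::euclidean_space \<Rightarrow> 'a"
  assumes g: "continuous_on UNIV g" "\<And>x. norm (g x) \<le> M"
    and Y: "continuous_on {0..} Y" and "0 \<le> s" "s \<le> t"
  shows "norm (tonelli_step g X d Y t - tonelli_step g X d Y s) \<le> M * (t - s)"
proof -
  let ?f = "\<lambda>\<tau>. g (Y (max 0 (\<tau> - d)))"
  have int: "?f integrable_on {a..b}" for a b
    by (intro integrable_continuous_real continuous_on_delayed g Y)
  have "integral {0..s} ?f + integral {s..t} ?f = integral {0..t} ?f"
    by (rule Henstock_Kurzweil_Integration.integral_combine) (use assms int in auto)
  then have "tonelli_step g X d Y t - tonelli_step g X d Y s = integral {s..t} ?f"
    by (simp add: tonelli_step_def algebra_simps)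
  also have "norm \<dots> \<le> M * (t - s)"
    by (rule integral_bound) (use assms continuous_on_delayed in auto)
  finally show ?thesis .
qed

lemma continuous_on_of_increment_bound:
  fixes Y :: "real \<Rightarrow> 'a::real_normed_vector"
  assumes "\<And>s t. 0 \<le> s \<Longrightarrow> s \<le> t \<Longrightarrow> norm (Y t - Y s) \<le> M * (t - s)" "M \<ge> 0"
  shows "continuous_on {0..} Y"
proof -
  have "M-lipschitz_on {0..} Y"
  proof (rule lipschitz_onI)
    fix s t :: real assume "s \<in> {0..}" "t \<in> {0..}"
    then show "dist (Y s) (Y t) \<le> M * dist s t"
      using assms(1)[of s t] assms(1)[of t s]
      by (cases s t rule: linorder_cases) (auto simp: dist_norm norm_minus_commute)
  qed (use assms in auto)
  then show ?thesis by (rule lipschitz_on_continuous_on)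
qed

lemma delay_equation_solution:
  fixes g :: "'a::euclidean_space \<Rightarrow> 'a"
  assumes g: "continuous_on UNIV g" "\<And>x. norm (g x) \<le> M" and "d > 0"
  obtains Y where "\<And>s t. 0 \<le> s \<Longrightarrow> s \<le> t \<Longrightarrow> norm (Y t - Y s) \<le> M * (t - s)"
    and "\<And>t. 0 \<le> t \<Longrightarrow> t \<le> T \<Longrightarrow>
           Y t = X + integral {0..t} (\<lambda>\<tau>. g (Y (max 0 (\<tau> - d))))"
proof -
  have M: "M \<ge> 0" using g(2)[of X] norm_ge_zero order_trans by blast
  define W where "W k = (tonelli_step g X d ^^ k) (\<lambda>_. X)" for k
  have W0: "W 0 = (\<lambda>_. X)" and WS: "W (Suc k) = tonelli_step g X d (W k)" for k
    by (simp_all add: W_def)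
  have lip: "norm (W k t - W k s) \<le> M * (t - s)" if "0 \<le> s" "s \<le> t" for k s t
    using that
  proof (induction k arbitrary: s t)
    case 0 then show ?case using M by (simp add: W0)
  next
    case (Suc k)
    have "continuous_on {0..} (W k)"
      by (rule continuous_on_of_increment_bound) (use Suc.IH M in auto)
    then show ?case
      unfolding WS by (intro tonelli_step_lipschitz g Suc.prems)
  qed
  \<comment> \<open>On \<open>[0, (k + 1) d]\<close> a step reads its argument only at times up to
    \<open>k d\<close>, where the two previous iterates agree by induction. For \<open>k = 0\<close>
    only \<open>t = 0\<close> remains, where the integral vanishes.\<close>
  have stable: "W (Suc k) t = W k t" if "0 \<le> t" "t \<le> k * d" for k t
    using that
  proof (induction k arbitrary: t)
    case 0 then show ?case by (simp add: W0 WS tonelli_step_def)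
  next
    case (Suc k)
    have "W (Suc k) (max 0 (\<tau> - d)) = W k (max 0 (\<tau> - d))" if "\<tau> \<in> {0..t}" for \<tau>
      by (rule Suc.IH) (use that Suc.prems \<open>d > 0\<close> in \<open>auto simp: algebra_simps\<close>)
    then show ?case
      unfolding WS[of "Suc k"] WS[of k] tonelli_step_def[of _ _ _ _ t]
      by (metis (no_types, lifting) WS Henstock_Kurzweil_Integration.integral_cong)
  qed
  \<comment> \<open>With \<open>k\<close> delays covering \<open>[0, T]\<close>, stationarity there
    says that \<open>W k\<close> is a fixed point of the step.\<close>
  obtain k :: nat where "T / d \<le> k" using real_arch_simple by blast
  then have k: "T \<le> k * d" using \<open>d > 0\<close> by (simp add: field_simps)
  show ?thesis
  proof (rule that[of "W k"])
    fix t :: real assume "0 \<le> t" "t \<le> T"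
    then show "W k t = X + integral {0..t} (\<lambda>\<tau>. g (W k (max 0 (\<tau> - d))))"
      using stable[of t k] k by (simp add: WS tonelli_step_def)
  qed (use lip in auto)
qed

text \<open>The delayed solutions are uniformly bounded and equi-Lipschitz on \<open>[0, T]\<close>.
  By Arzela-Ascoli a subsequence converges uniformly as the delay tends to 0, and the limit
  satisfies the undelayed integral equation. The bound on \<open>Z t - X\<close> is inherited from
  the approximations and serves to localise in \<open>peano\<close>.\<close>

lemma peano_bounded:
  fixes g :: "'a::euclidean_space \<Rightarrow> 'a"
  assumes g: "continuous_on UNIV g" "\<And>x. norm (g x) \<le> M" and "T \<ge> 0"
  obtains Z where "ode_solution g X T Z" "\<And>t. t \<in> {0..T} \<Longrightarrow> norm (Z t - X) \<le> M * t"
proof -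
  have M: "M \<ge> 0" using g(2)[of X] norm_ge_zero order_trans by blast
  define d :: "nat \<Rightarrow> real" where "d n = inverse (Suc n)" for n
  have "\<exists>Y. (\<forall>s t. 0 \<le> s \<longrightarrow> s \<le> t \<longrightarrow> norm (Y t - Y s) \<le> M * (t - s)) \<and>
      (\<forall>t. 0 \<le> t \<longrightarrow> t \<le> T \<longrightarrow>
         Y t = X + integral {0..t} (\<lambda>\<tau>. g (Y (max 0 (\<tau> - d n)))))" for n
    by (rule delay_equation_solution[OF g, of "d n" T X]) (auto simp: d_def)
  then obtain Y where lip: "\<And>n s t. 0 \<le> s \<Longrightarrow> s \<le> t \<Longrightarrow> norm (Y n t - Y n s) \<le> M * (t - s)"
    and Y: "\<And>n t. 0 \<le> t \<Longrightarrow> t \<le> T \<Longrightarrow>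
         Y n t = X + integral {0..t} (\<lambda>\<tau>. g (Y n (max 0 (\<tau> - d n))))"
    by metis
  have Y0: "Y n 0 = X" for n using Y[of 0 n] \<open>T \<ge> 0\<close> by simp
  have near: "norm (Y n t - X) \<le> M * t" if "0 \<le> t" for n t
    using lip[of 0 t n] that by (simp add: Y0)
  have cY: "continuous_on {0..} (Y n)" for n
    by (rule continuous_on_of_increment_bound) (use lip M in auto)
  obtain Z k where Z: "continuous_on {0..T} Z" and k: "strict_mono (k :: nat \<Rightarrow> nat)"
    and lim: "\<And>e. 0 < e \<Longrightarrow> \<exists>N. \<forall>n x. n \<ge> N \<and> x \<in> {0..T} \<longrightarrow> norm (Y (k n) x - Z x) < e"
  proof (rule Arzela_Ascoli[of "{0..T}" Y "norm X + M * T"])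
    fix n t assume "t \<in> {0..T}"
    then have "norm (Y n t - X) \<le> M * T"
      using near[of t n] M by (meson atLeastAtMost_iff mult_left_mono order_trans)
    then show "norm (Y n t) \<le> norm X + M * T"
      by (smt (verit) norm_triangle_sub)
  next
    fix x e :: real assume x: "x \<in> {0..T}" and e: "0 < e"
    \<comment> \<open>Dividing by \<open>M + 1\<close> rather than \<open>M\<close> covers the case
      \<open>M = 0\<close>.\<close>
    have "norm (Y n x - Y n y) < e" if "y \<in> {0..T}" "norm (x - y) < e / (M + 1)" for n y
    proof -
      have "norm (Y n x - Y n y) \<le> M * \<bar>x - y\<bar>"
        using lip[of x y n] lip[of y x n] x that
        by (cases "x \<le> y") (auto simp: norm_minus_commute abs_if)
      also have "\<dots> \<le> (M + 1) * \<bar>x - y\<bar>" by (simp add: mult_right_mono)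
      also have "\<dots> < e" using that M by (simp add: field_simps)
      finally show ?thesis .
    qed
    then show "\<exists>\<delta>. 0 < \<delta> \<and> (\<forall>n y. y \<in> {0..T} \<and> norm (x - y) < \<delta> \<longrightarrow> norm (Y n x - Y n y) < e)"
      using e M by (intro exI[of _ "e / (M + 1)"]) auto
  qed auto
  have conv: "(\<lambda>n. Y (k n) t) \<longlonglongrightarrow> Z t" if "t \<in> {0..T}" for t
    unfolding LIMSEQ_iff using lim that by blast
  have "d \<longlonglongrightarrow> 0" unfolding d_def by (rule LIMSEQ_inverse_real_of_nat)
  then have dk: "(\<lambda>n. d (k n)) \<longlonglongrightarrow> 0"
    using LIMSEQ_subseq_LIMSEQ[OF _ k] by (force simp: o_def)
  \<comment> \<open>The delay moves the value by at most \<open>M * d (k n)\<close>, so it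
    disappears in the limit.\<close>
  have conv_delayed: "(\<lambda>n. Y (k n) (max 0 (t - d (k n)))) \<longlonglongrightarrow> Z t" if t: "t \<in> {0..T}" for t
  proof -
    have "norm (Y (k n) (max 0 (t - d (k n))) - Y (k n) t) \<le> M * d (k n)" for n
    proof -
      have "d (k n) > 0" by (simp add: d_def)
      then have "norm (Y (k n) t - Y (k n) (max 0 (t - d (k n)))) \<le> M * (t - max 0 (t - d (k n)))"
        using t by (intro lip) auto
      also have "\<dots> \<le> M * d (k n)" using M by (intro mult_left_mono) auto
      finally show ?thesis by (simp add: norm_minus_commute)
    qed
    moreover have "(\<lambda>n. M * d (k n)) \<longlonglongrightarrow> 0" using tendsto_mult_right_zero[OF dk] .
    ultimately have "(\<lambda>n. Y (k n) (max 0 (t - d (k n))) - Y (k n) t) \<longlonglongrightarrow> 0"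
      by (metis (no_types, lifting) Lim_null_comparison always_eventually)
    from tendsto_add[OF this conv[OF t]] show ?thesis by simp
  qed
  have Z_eq: "Z t = X + integral {0..t} (\<lambda>\<tau>. g (Z \<tau>))" if t: "t \<in> {0..T}" for t
  proof -
    have "(\<lambda>n. integral {0..t} (\<lambda>\<tau>. g (Y (k n) (max 0 (\<tau> - d (k n))))))
        \<longlonglongrightarrow> integral {0..t} (\<lambda>\<tau>. g (Z \<tau>))"
    proof (rule dominated_convergence(2)[where h = "\<lambda>_. M"])
      show "(\<lambda>\<tau>. g (Y (k n) (max 0 (\<tau> - d (k n))))) integrable_on {0..t}" for n
        by (intro integrable_continuous_real continuous_on_delayed g cY)
      show "(\<lambda>n. g (Y (k n) (max 0 (\<tau> - d (k n))))) \<longlonglongrightarrow> g (Z \<tau>)" if "\<tau> \<in> {0..t}" for \<tau>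
        using g(1) conv_delayed[of \<tau>] that t
        by (intro isCont_tendsto_compose[of _ g]) (auto simp: continuous_on_eq_continuous_at)
    qed (use g in auto)
    then have "(\<lambda>n. Y (k n) t) \<longlonglongrightarrow> X + integral {0..t} (\<lambda>\<tau>. g (Z \<tau>))"
      using t by (subst Y) (auto intro!: tendsto_intros)
    then show ?thesis using conv[OF t] LIMSEQ_unique by blast
  qed
  have cgZ: "continuous_on {0..T} (\<lambda>\<tau>. g (Z \<tau>))"
    by (intro continuous_on_compose2[OF g(1)] Z) auto
  show ?thesis
  proof
    have "(Z has_vector_derivative g (Z t)) (at t within {0..T})" if t: "t \<in> {0..T}" for t
    proof (rule has_vector_derivative_transform[OF t])
      show "((\<lambda>t. X + integral {0..t} (\<lambda>\<tau>. g (Z \<tau>))) has_vector_derivative g (Z t)) (at t within {0..T})"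
        using has_vector_derivative_add[OF has_vector_derivative_const
            integral_has_vector_derivative[OF cgZ t]] by simp
    qed (use Z_eq in auto)
    moreover have "Z 0 = X" using Z_eq[of 0] \<open>T \<ge> 0\<close> by simp
    ultimately show "ode_solution g X T Z" by (simp add: ode_solution_def)
    show "norm (Z t - X) \<le> M * t" if "t \<in> {0..T}" for t
      by (rule LIMSEQ_le_const2[OF tendsto_norm[OF tendsto_diff[OF conv[OF that] tendsto_const]]])
        (use near that in auto)
  qed
qed

text \<open>Composing \<open>f\<close> with the nearest point projection onto the ball gives a
  globally continuous field with the same bound. Its solution travels at most
  \<open>M * T \<le> r\<close>, hence stays in the ball, where the projection is the
  identity.\<close>

lemma peano:
  fixes f :: "'a::euclidean_space \<Rightarrow> 'a"
  assumes f: "continuous_on (cball X r) f" "\<And>Z. Z \<in> cball X r \<Longrightarrow> norm (f Z) \<le> M"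
    and "r \<ge> 0" "T \<ge> 0" "M * T \<le> r"
  obtains Z where "ode_solution f X T Z"
proof -
  let ?p = "closest_point (cball X r)"
  have p: "?p Z \<in> cball X r" for Z using \<open>r \<ge> 0\<close> by (intro closest_point_in_set) auto
  have M: "M \<ge> 0" using f(2)[of X] \<open>r \<ge> 0\<close> norm_ge_zero[of "f X"] by (metis centre_in_cball order_trans)
  have "continuous_on UNIV (\<lambda>Z. f (?p Z))"
    using p \<open>r \<ge> 0\<close> by (intro continuous_on_compose2[OF f(1)] continuous_on_closest_point) auto
  then obtain Z where Z: "ode_solution (\<lambda>Z. f (?p Z)) X T Z"
    and near: "\<And>t. t \<in> {0..T} \<Longrightarrow> norm (Z t - X) \<le> M * t"
    using peano_bounded[of "\<lambda>Z. f (?p Z)" M T X] f(2) p \<open>T \<ge> 0\<close> by blast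
  have "?p (Z t) = Z t" if "t \<in> {0..T}" for t
  proof (rule closest_point_self)
    have "M * t \<le> M * T" using M that by (intro mult_left_mono) auto
    then show "Z t \<in> cball X r"
      using near[OF that] \<open>M * T \<le> r\<close> by (simp add: dist_norm norm_minus_commute)
  qed
  then have "ode_solution f X T Z" using Z by (simp add: ode_solution_def)
  then show ?thesis by (rule that)
qed

section \<open>Expansion of solutions in the square root of the step size\<close>

text \<open>This is the mean value inequality for \<open>Y - p\<close>. The trial curve
  \<open>p\<close> will be zero, linear or quadratic, and \<open>B\<close> bounds the mismatch of
  velocities at interior times, where the derivative of \<open>Y\<close> is two-sided.\<close>

lemma ode_solution_deviation:
  fixes f :: "'a::euclidean_space \<Rightarrow> 'a"
  assumes Y: "ode_solution f X T Y" and t: "0 \<le> t" "t \<le> T"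
    and p: "\<And>\<tau>. (p has_vector_derivative p' \<tau>) (at \<tau>)" "p 0 = 0"
    and B: "\<And>\<tau>. 0 < \<tau> \<Longrightarrow> \<tau> < t \<Longrightarrow> norm (f (Y \<tau>) - p' \<tau>) \<le> B"
  shows "norm (Y t - X - p t) \<le> B * t"
proof (cases "t = 0")
  case True
  then show ?thesis using Y p by (simp add: ode_solution_def)
next
  case False
  have Y0: "Y 0 = X"
    and dY: "\<And>\<tau>. \<tau> \<in> {0..T} \<Longrightarrow> (Y has_vector_derivative f (Y \<tau>)) (at \<tau> within {0..T})"
    using Y by (auto simp: ode_solution_def)
  have cY: "continuous_on {0..t} Y"
    using continuous_on_vector_derivative[OF dY] by (rule continuous_on_subset) (use t in auto)
  have cp: "continuous_on {0..t} p"
    using p(1) by (meson has_vector_derivative_at_within continuous_on_vector_derivative)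
  have "\<exists>\<tau>\<in>{0<..<t}. norm ((Y t - p t) - (Y 0 - p 0)) \<le> norm ((t - 0) *\<^sub>R (f (Y \<tau>) - p' \<tau>))"
  proof (rule mvt_general)
    fix \<tau> assume \<tau>: "0 < \<tau>" "\<tau> < t"
    then have "(Y has_vector_derivative f (Y \<tau>)) (at \<tau>)"
      using dY[of \<tau>] t at_within_Icc_at[of 0 \<tau> T] by simp
    then show "((\<lambda>\<tau>. Y \<tau> - p \<tau>) has_derivative (\<lambda>u. u *\<^sub>R (f (Y \<tau>) - p' \<tau>))) (at \<tau>)"
      using has_vector_derivative_diff[OF _ p(1)] by (simp add: has_vector_derivative_def)
  qed (use False t cY cp in \<open>auto intro!: continuous_intros\<close>)
  moreover have "(Y t - p t) - (Y 0 - p 0) = Y t - X - p t" using Y0 p by simp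
  ultimately obtain \<tau> where \<tau>: "0 < \<tau>" "\<tau> < t"
    and le: "norm (Y t - X - p t) \<le> t * norm (f (Y \<tau>) - p' \<tau>)"
    using t by (auto simp del: scaleR_diff_right)
  have "t * norm (f (Y \<tau>) - p' \<tau>) \<le> t * B"
    using B[OF \<tau>] t by (intro mult_left_mono) auto
  then show ?thesis using le by (simp add: mult.commute)
qed

text \<open>First exit argument: until the distance \<open>r\<close> is first reached the speed is
  at most \<open>M\<close>, so the distance at that time would be at most
  \<open>M * T < r\<close>.\<close>

lemma ode_solution_in_ball:
  fixes f :: "'a::euclidean_space \<Rightarrow> 'a"
  assumes Y: "ode_solution f X T Y"
    and M: "\<And>Z. dist Z X < r \<Longrightarrow> norm (f Z) \<le> M" and "r > 0" "M * T < r" and t: "t \<in> {0..T}"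
  shows "dist (Y t) X < r"
proof (rule ccontr)
  assume exit: "\<not> dist (Y t) X < r"
  have cY: "continuous_on {0..T} Y"
    using Y unfolding ode_solution_def by (intro continuous_on_vector_derivative) blast
  let ?S = "{\<tau> \<in> {0..T}. r \<le> dist (Y \<tau>) X}"
  have "closed ?S"
    by (intro continuous_on_closed_Collect_le continuous_intros cY closed_atLeastAtMost)
  moreover have "bounded ?S" by (rule bounded_subset[OF bounded_closed_interval[of 0 T]]) auto
  ultimately have "compact ?S" by (simp add: compact_eq_bounded_closed)
  moreover have "?S \<noteq> {}" using exit t by auto
  ultimately obtain t0 where t0: "t0 \<in> ?S" and first: "\<And>\<tau>. \<tau> \<in> ?S \<Longrightarrow> t0 \<le> \<tau>"
    using compact_attains_inf[of ?S] by blast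
  have "norm (Y t0 - X - 0) \<le> M * t0"
  proof (rule ode_solution_deviation[OF Y, where p = "\<lambda>_. 0" and p' = "\<lambda>_. 0"])
    fix \<tau> assume "0 < \<tau>" "\<tau> < t0"
    then have "dist (Y \<tau>) X < r" using first[of \<tau>] t0 by (cases "r \<le> dist (Y \<tau>) X") auto
    then show "norm (f (Y \<tau>) - 0) \<le> M" using M by simp
  qed (use t0 in auto)
  moreover have "M * t0 \<le> M * T"
    using t0 M[of X] \<open>r > 0\<close> by (intro mult_left_mono order_trans[OF norm_ge_zero]) auto
  ultimately show False using t0 \<open>M * T < r\<close> by (auto simp: dist_norm)
qed

section \<open>Small step sizes and local solvability\<close>

lemma eventually_sqrt_less:
  fixes c C :: real
  assumes "c > 0"
  shows "\<forall>\<^sub>F s in at_right 0. C * sqrt s < c"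
proof -
  have "((\<lambda>s. C * sqrt s) \<longlongrightarrow> C * sqrt 0) (at_right 0)" by (intro tendsto_intros)
  then show ?thesis using assms by (auto dest: order_tendstoD(2))
qed

lemma eventually_pos_at_right: "\<forall>\<^sub>F s::real in at_right 0. 0 < s"
  by (simp add: eventually_at_filter)

lemma continuous_bound_cball:
  fixes f :: "'a::euclidean_space \<Rightarrow> 'a"
  assumes "continuous_on UNIV f"
  obtains M where "M \<ge> 0" "\<And>Z. dist Z X \<le> r \<Longrightarrow> norm (f Z) \<le> M"
proof -
  have "bounded (f ` cball X r)"
    by (intro compact_imp_bounded compact_continuous_image continuous_on_subset[OF assms]) auto
  then obtain M where "M > 0" "\<And>y. y \<in> f ` cball X r \<Longrightarrow> norm y \<le> M"
    unfolding bounded_pos by blast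
  then show ?thesis using that[of M] by (auto simp: dist_commute)
qed

text \<open>For \<open>sqrt s < 1\<close> the field is bounded by \<open>K + N\<close> on the unit
  ball, uniformly in \<open>s\<close>. The time \<open>sqrt s\<close> is then eventually short
  enough for \<open>peano\<close>.\<close>

lemma perturbed_ode_solvable:
  fixes A B :: "'a::euclidean_space \<Rightarrow> 'a"
  assumes A: "continuous_on UNIV A" and B: "continuous_on UNIV B"
  shows "\<forall>\<^sub>F s in at_right 0. \<exists>Y. ode_solution (\<lambda>Z. A Z + sqrt s *\<^sub>R B Z) X (sqrt s) Y"
proof -
  obtain K where K: "K \<ge> 0" "\<And>Z. dist Z X \<le> 1 \<Longrightarrow> norm (A Z) \<le> K"
    using continuous_bound_cball[OF A] by blast
  obtain N where N: "N \<ge> 0" "\<And>Z. dist Z X \<le> 1 \<Longrightarrow> norm (B Z) \<le> N"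
    using continuous_bound_cball[OF B] by blast
  \<comment> \<open>The factor 1 puts the condition into the shape of
    \<open>eventually_sqrt_less\<close>.\<close>
  have "\<forall>\<^sub>F s in at_right 0. 0 < s \<and> 1 * sqrt s < 1 \<and> (K + N) * sqrt s < 1"
    by (intro eventually_conj eventually_sqrt_less eventually_pos_at_right) auto
  then show ?thesis
  proof eventually_elim
    case (elim s)
    show ?case
    proof (rule peano[of X 1 "\<lambda>Z. A Z + sqrt s *\<^sub>R B Z" "K + N" "sqrt s"])
      show "continuous_on (cball X 1) (\<lambda>Z. A Z + sqrt s *\<^sub>R B Z)"
        by (intro continuous_intros continuous_on_subset[OF A] continuous_on_subset[OF B]) auto
      show "norm (A Z + sqrt s *\<^sub>R B Z) \<le> K + N" if "Z \<in> cball X 1" for Z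
      proof -
        have "dist Z X \<le> 1" using that by (simp add: dist_commute)
        moreover have "sqrt s * norm (B Z) \<le> 1 * norm (B Z)"
          using elim by (intro mult_right_mono) auto
        ultimately show ?thesis
          using K(2)[of Z] N(2)[of Z] elim norm_triangle_ineq[of "A Z" "sqrt s *\<^sub>R B Z"] by simp
      qed
    qed (use elim in auto)
  qed
qed

section \<open>Taylor expansion of a family of solutions\<close>

context
  fixes A B :: "'a::euclidean_space \<Rightarrow> 'a" and X :: 'a and Y :: "real \<Rightarrow> real \<Rightarrow> 'a"
  assumes A: "continuous_on UNIV A" and B: "continuous_on UNIV B"
    and Y: "\<forall>\<^sub>F s in at_right 0. ode_solution (\<lambda>Z. A Z + sqrt s *\<^sub>R B Z) X (sqrt s) (Y s)"
begin

text \<open>The speed near \<open>X\<close> is bounded uniformly in \<open>s\<close>, while the time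
  interval shrinks to a point.\<close>

lemma solution_stays_near:
  assumes "\<delta> > 0"
  shows "\<forall>\<^sub>F s in at_right 0. \<forall>t\<in>{0..sqrt s}. dist (Y s t) X < \<delta>"
proof -
  obtain K where K: "K \<ge> 0" "\<And>Z. dist Z X \<le> \<delta> \<Longrightarrow> norm (A Z) \<le> K"
    using continuous_bound_cball[OF A] by blast
  obtain N where N: "N \<ge> 0" "\<And>Z. dist Z X \<le> \<delta> \<Longrightarrow> norm (B Z) \<le> N"
    using continuous_bound_cball[OF B] by blast
  have "\<forall>\<^sub>F s in at_right 0. 0 < s \<and> 1 * sqrt s < 1 \<and> (K + N) * sqrt s < \<delta>"
    using assms by (intro eventually_conj eventually_sqrt_less eventually_pos_at_right) auto
  with Y show ?thesis
  proof eventually_elim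
    case (elim s)
    show ?case
    proof
      fix t assume t: "t \<in> {0..sqrt s}"
      show "dist (Y s t) X < \<delta>"
      proof (rule ode_solution_in_ball[OF elim(1) _ assms _ t, where M = "K + N"])
        fix Z assume "dist Z X < \<delta>"
        moreover have "sqrt s * norm (B Z) \<le> 1 * norm (B Z)"
          using elim by (intro mult_right_mono) auto
        ultimately show "norm (A Z + sqrt s *\<^sub>R B Z) \<le> K + N"
          using K(2)[of Z] N(2)[of Z] elim norm_triangle_ineq[of "A Z" "sqrt s *\<^sub>R B Z"] by simp
      qed (use elim in auto)
    qed
  qed
qed

text \<open>By continuity of \<open>A\<close> the velocity is \<open>A X\<close> up to a small
  error, and the term with \<open>sqrt s\<close> is absorbed in that error. Uniformity in
  \<open>t\<close> is what the second order expansion requires; the uniqueness proof applies the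
  lemma to a field \<open>G0\<close> known only to be continuous.\<close>

lemma solution_expansion_first_order:
  assumes "\<epsilon> > 0"
  shows "\<forall>\<^sub>F s in at_right 0. \<forall>t\<in>{0..sqrt s}. norm (Y s t - X - t *\<^sub>R A X) \<le> \<epsilon> * sqrt s"
proof -
  obtain \<delta> where \<delta>: "\<delta> > 0" "\<And>Z. dist Z X < \<delta> \<Longrightarrow> dist (A Z) (A X) < \<epsilon> / 2"
    using A half_gt_zero[OF assms] unfolding continuous_on_iff by (metis UNIV_I)
  obtain N where N: "N \<ge> 0" "\<And>Z. dist Z X \<le> \<delta> \<Longrightarrow> norm (B Z) \<le> N"
    using continuous_bound_cball[OF B] by blast
  have "\<forall>\<^sub>F s in at_right 0. 0 < s \<and> N * sqrt s < \<epsilon> / 2"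
    using assms by (intro eventually_conj eventually_sqrt_less eventually_pos_at_right) auto
  with Y solution_stays_near[OF \<delta>(1)] show ?thesis
  proof eventually_elim
    case (elim s)
    show ?case
    proof
      fix t assume t: "t \<in> {0..sqrt s}"
      have "norm (Y s t - X - t *\<^sub>R A X) \<le> \<epsilon> * t"
      proof (rule ode_solution_deviation[OF elim(1), where p' = "\<lambda>_. A X"])
        fix \<tau> assume "0 < \<tau>" "\<tau> < t"
        then have near: "dist (Y s \<tau>) X < \<delta>" using elim t by auto
        have "norm (sqrt s *\<^sub>R B (Y s \<tau>)) = norm (B (Y s \<tau>)) * sqrt s" using elim by simp
        also have "\<dots> \<le> N * sqrt s"
          using N(2)[of "Y s \<tau>"] near elim by (intro mult_right_mono) auto
        also have "\<dots> \<le> \<epsilon> / 2" using elim by linarith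
        finally have "norm (sqrt s *\<^sub>R B (Y s \<tau>)) \<le> \<epsilon> / 2" .
        moreover have "norm (A (Y s \<tau>) - A X) \<le> \<epsilon> / 2" using \<delta>(2)[OF near] by (simp add: dist_norm)
        ultimately have "norm ((A (Y s \<tau>) - A X) + sqrt s *\<^sub>R B (Y s \<tau>)) \<le> \<epsilon> / 2 + \<epsilon> / 2"
          by (intro norm_triangle_le add_mono)
        then show "norm (A (Y s \<tau>) + sqrt s *\<^sub>R B (Y s \<tau>) - A X) \<le> \<epsilon>"
          by (simp add: algebra_simps)
      qed (use t in \<open>auto intro!: derivative_eq_intros\<close>)
      also have "\<epsilon> * t \<le> \<epsilon> * sqrt s" using t assms by (intro mult_left_mono) auto
      finally show "norm (Y s t - X - t *\<^sub>R A X) \<le> \<epsilon> * sqrt s" .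
    qed
  qed
qed

text \<open>The velocity at time \<open>\<tau>\<close> is compared with
  \<open>A X + h B X + \<tau> L (A X)\<close>. Its antiderivative at \<open>\<tau> = h\<close>
  carries the factor 1/2 in front of \<open>L (A X)\<close> but not in front of
  \<open>B X\<close>.\<close>

lemma solution_expansion_second_order:
  assumes L: "(A has_derivative L) (at X)"
  shows "(\<lambda>s. norm (Y s (sqrt s) - (X + sqrt s *\<^sub>R A X + s *\<^sub>R (B X + (1/2) *\<^sub>R L (A X)))))
           \<in> o[at_right 0](\<lambda>s. s)"
proof (rule landau_o.smallI)
  fix c :: real assume c: "c > 0"
  interpret L: bounded_linear L using L by (rule has_derivative_bounded_linear)
  obtain K where K: "K > 0" "\<And>z. norm (L z) \<le> norm z * K" using L.pos_bounded by blast
  \<comment> \<open>\<open>N * h\<close> will bound the distance of the solution from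
    \<open>X\<close>, so the choice of \<open>e\<close> makes the linearisation error of
    \<open>A\<close> at most \<open>c / 3 * h\<close>.\<close>
  define N where "N = norm (A X) + 1"
  define e where "e = c / (3 * N)"
  have N: "N > 0" by (simp add: N_def add_nonneg_pos)
  have e: "e > 0" using c N by (simp add: e_def)
  obtain \<delta>1 where \<delta>1: "\<delta>1 > 0"
    "\<And>Z. norm (Z - X) < \<delta>1 \<Longrightarrow> norm (A Z - A X - L (Z - X)) \<le> e * norm (Z - X)"
    using L e unfolding has_derivative_at_alt by meson
  obtain \<delta>2 where \<delta>2: "\<delta>2 > 0" "\<And>Z. dist Z X < \<delta>2 \<Longrightarrow> dist (B Z) (B X) < c / 3"
    using B c unfolding continuous_on_iff by (metis UNIV_I divide_pos_pos zero_less_numeral)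
  \<comment> \<open>The cap 1 justifies the bound \<open>N * h\<close>; the other entry keeps the
    image under \<open>L\<close> of the first order error below \<open>c / 3 * h\<close>.\<close>
  define \<epsilon> where "\<epsilon> = min 1 (c / (3 * K))"
  have \<epsilon>: "\<epsilon> > 0" "\<epsilon> \<le> 1" "\<epsilon> * K \<le> c / 3"
    using c K by (auto simp: \<epsilon>_def min_def field_simps)
  have "min \<delta>1 \<delta>2 > 0" using \<delta>1 \<delta>2 by simp
  from Y solution_stays_near[OF this] solution_expansion_first_order[OF \<epsilon>(1)]
    eventually_pos_at_right
  show "\<forall>\<^sub>F s in at_right 0.
      norm (norm (Y s (sqrt s) - (X + sqrt s *\<^sub>R A X + s *\<^sub>R (B X + (1/2) *\<^sub>R L (A X)))))
        \<le> c * norm s"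
  proof eventually_elim
    case (elim s)
    define h where "h = sqrt s"
    have h: "h > 0" "h * h = s" using elim by (auto simp: h_def)
    define p where "p t = t *\<^sub>R (A X + h *\<^sub>R B X) + (t * t / 2) *\<^sub>R L (A X)" for t
    have "norm (Y s h - X - p h) \<le> (c * h) * h"
    proof (rule ode_solution_deviation[OF elim(1)[folded h_def],
          where p' = "\<lambda>t. A X + h *\<^sub>R B X + t *\<^sub>R L (A X)"])
      show "(p has_vector_derivative A X + h *\<^sub>R B X + t *\<^sub>R L (A X)) (at t)" for t
        unfolding p_def by (auto intro!: derivative_eq_intros)
      fix \<tau> assume \<tau>: "0 < \<tau>" "\<tau> < h"
      define Z where "Z = Y s \<tau>"
      have near: "norm (Z - X) < \<delta>1" "dist Z X < \<delta>2"
        and first: "norm (Z - X - \<tau> *\<^sub>R A X) \<le> \<epsilon> * h"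
        using elim \<tau> by (auto simp: Z_def h_def dist_norm)
      have "norm (Z - X) \<le> norm (Z - X - \<tau> *\<^sub>R A X) + norm (\<tau> *\<^sub>R A X)"
        using norm_triangle_ineq[of "Z - X - \<tau> *\<^sub>R A X" "\<tau> *\<^sub>R A X"] by simp
      also have "\<dots> \<le> 1 * h + h * norm (A X)"
        using \<tau> \<epsilon> h first
        by (intro add_mono order_trans[OF first] mult_right_mono) (auto intro: mult_right_mono)
      finally have ZX: "norm (Z - X) \<le> N * h" by (simp add: N_def algebra_simps)
      have "norm (A Z - A X - L (Z - X)) \<le> e * (N * h)"
        using \<delta>1(2)[OF near(1)] mult_left_mono[OF ZX, of e] e by linarith
      also have "\<dots> = c / 3 * h" using N by (simp add: e_def)
      finally have 1: "norm (A Z - A X - L (Z - X)) \<le> c / 3 * h" .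
      have 2: "norm (h *\<^sub>R (B Z - B X)) \<le> c / 3 * h"
        using \<delta>2(2)[OF near(2)] h by (simp add: dist_norm)
      have "norm (L (Z - X - \<tau> *\<^sub>R A X)) \<le> (\<epsilon> * h) * K"
        using K first by (meson order_trans mult_right_mono less_imp_le)
      also have "\<dots> \<le> c / 3 * h"
        using mult_right_mono[OF \<epsilon>(3), of h] h by (simp add: mult_ac)
      finally have 3: "norm (L (Z - X - \<tau> *\<^sub>R A X)) \<le> c / 3 * h" .
      \<comment> \<open>The velocity mismatch splits into the linearisation error of
        \<open>A\<close>, the oscillation of \<open>B\<close>, and \<open>L\<close> applied to the
        first order error.\<close>
      have "A Z + h *\<^sub>R B Z - (A X + h *\<^sub>R B X + \<tau> *\<^sub>R L (A X)) =
          (A Z - A X - L (Z - X)) + h *\<^sub>R (B Z - B X) + L (Z - X - \<tau> *\<^sub>R A X)"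
        by (simp add: L.diff L.add L.scaleR algebra_simps)
      also have "norm \<dots> \<le> c / 3 * h + c / 3 * h + c / 3 * h"
        using 1 2 3 by (intro norm_triangle_le add_mono)
      finally show "norm (A (Y s \<tau>) + h *\<^sub>R B (Y s \<tau>) - (A X + h *\<^sub>R B X + \<tau> *\<^sub>R L (A X))) \<le> c * h"
        by (simp add: Z_def)
    qed (use h in \<open>auto simp: p_def\<close>)
    moreover have "Y s h - X - p h = Y s h - (X + h *\<^sub>R A X + s *\<^sub>R (B X + (1/2) *\<^sub>R L (A X)))"
      by (simp add: p_def algebra_simps flip: h(2))
    ultimately show ?case
      using elim by (simp add: h(2) mult.assoc flip: h_def)
  qed
qed

end

section \<open>Resolution ODEs of templates with a second order expansion\<close>

text \<open>Template and solutions share the same second order polynomial in \<open>sqrt s\<close>,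
  so they differ by \<open>o(s)\<close>. Conversely, its coefficients determine first
  \<open>A\<close> and then \<open>B\<close>.\<close>

lemma the_sqrt_resolution_ode_of_expansion:
  fixes A B :: "'a::euclidean_space \<Rightarrow> 'a"
  assumes \<Phi>0: "\<And>X. \<Phi> X 0 = X"
    and \<Phi>: "\<And>X. (\<lambda>s. norm (\<Phi> X (sqrt s) -
              (X + sqrt s *\<^sub>R A X + s *\<^sub>R (B X + (1/2) *\<^sub>R L X (A X))))) \<in> o[at_right 0](\<lambda>s. s)"
    and L: "\<And>X. (A has_derivative L X) (at X)" and B: "continuous_on UNIV B"
  shows "the_sqrt_resolution_ode \<Phi> A B"
proof -
  let ?C = "\<lambda>X. B X + (1/2) *\<^sub>R L X (A X)"
  have A: "continuous_on UNIV A"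
    using L has_derivative_continuous continuous_at_imp_continuous_on by blast
  have small: "\<forall>\<^sub>F s in at_right 0. norm (D s) \<le> c * s"
    if "(\<lambda>s. norm (D s :: 'a)) \<in> o[at_right 0](\<lambda>s. s)" "c > 0" for D c
    using landau_o.smallD[OF that] eventually_pos_at_right by eventually_elim simp
  have "sqrt_resolution_ode \<Phi> A B"
    unfolding sqrt_resolution_ode_def
  proof (intro conjI allI impI \<Phi>0 perturbed_ode_solvable A B)
    fix X :: 'a and Y :: "real \<Rightarrow> real \<Rightarrow> 'a"
    assume Y: "\<forall>\<^sub>F s in at_right 0. ode_solution (\<lambda>Z. A Z + sqrt s *\<^sub>R B Z) X (sqrt s) (Y s)"
    show "(\<lambda>s. norm (Y s (sqrt s) - \<Phi> X (sqrt s))) \<in> o[at_right 0](\<lambda>s. s)"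
    proof (rule landau_o.smallI)
      fix c :: real assume "c > 0"
      then have "c / 2 > 0" by simp
      from small[OF solution_expansion_second_order[OF A B Y L] this] small[OF \<Phi>[of X] this]
        eventually_pos_at_right
      show "\<forall>\<^sub>F s in at_right 0. norm (norm (Y s (sqrt s) - \<Phi> X (sqrt s))) \<le> c * norm s"
      proof eventually_elim
        case (elim s)
        then show ?case
          using norm_triangle_ineq4[of "Y s (sqrt s) - (X + sqrt s *\<^sub>R A X + s *\<^sub>R ?C X)"
              "\<Phi> X (sqrt s) - (X + sqrt s *\<^sub>R A X + s *\<^sub>R ?C X)"] by simp
      qed
    qed
  qed
  moreover have "G0 = A \<and> G1 = B"
    if G: "continuous_on UNIV G0" "continuous_on UNIV G1"
      and R: "sqrt_resolution_ode \<Phi> G0 G1" for G0 G1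
  proof -
    \<comment> \<open>This selects a family of solutions of the competing equation. Where no
      solution exists the choice is arbitrary, which is harmless since one exists for all small
      \<open>s\<close>.\<close>
    define Y where "Y X s = (SOME Y. ode_solution (\<lambda>Z. G0 Z + sqrt s *\<^sub>R G1 Z) X (sqrt s) Y)" for X s
    have Y: "\<forall>\<^sub>F s in at_right 0. ode_solution (\<lambda>Z. G0 Z + sqrt s *\<^sub>R G1 Z) X (sqrt s) (Y X s)" for X
      using perturbed_ode_solvable[OF G, of X] unfolding Y_def
      by (rule eventually_mono) (erule someI_ex)
    then have close: "(\<lambda>s. norm (Y X s (sqrt s) - \<Phi> X (sqrt s))) \<in> o[at_right 0](\<lambda>s. s)" for X
      using R unfolding sqrt_resolution_ode_def by blast
    have "G0 X = A X" for X
    proof (rule ccontr)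
      define a where "a = norm (G0 X - A X)"
      assume "G0 X \<noteq> A X"
      then have "a / 4 > 0" by (simp add: a_def)
      \<comment> \<open>The 2 collects two errors bounded by \<open>s\<close>: solution against
        template and template against polynomial. With \<open>a / 4\<close> from the first order
        expansion the total falls below \<open>a / 2\<close>, contradicting that it bounds
        \<open>a\<close>.\<close>
      have "\<forall>\<^sub>F s in at_right 0. (2 + norm (?C X)) * sqrt s < a / 4"
        by (rule eventually_sqrt_less) fact
      with eventually_pos_at_right solution_expansion_first_order[OF G Y[of X] \<open>a / 4 > 0\<close>]
        small[OF close[of X] zero_less_one] small[OF \<Phi>[of X] zero_less_one]
      have "\<forall>\<^sub>F s::real in at_right 0. False"
      proof eventually_elim
        case (elim s)
        define h where "h = sqrt s"
        have h: "h > 0" "s = h * h" using elim by (auto simp: h_def)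
        have 1: "norm (Y X s h - X - h *\<^sub>R G0 X) \<le> a / 4 * h"
          and 2: "norm (Y X s h - \<Phi> X h) \<le> s"
          and 3: "norm (\<Phi> X h - (X + h *\<^sub>R A X + s *\<^sub>R ?C X)) \<le> s"
          using elim by (auto simp: h_def)
        have "h * a = norm (h *\<^sub>R (G0 X - A X))" using h by (simp add: a_def)
        also have "h *\<^sub>R (G0 X - A X) = - (Y X s h - X - h *\<^sub>R G0 X) + (Y X s h - \<Phi> X h)
            + (\<Phi> X h - (X + h *\<^sub>R A X + s *\<^sub>R ?C X)) + s *\<^sub>R ?C X"
          by (simp add: algebra_simps)
        also have "norm \<dots> \<le> a / 4 * h + s + s + s * norm (?C X)"
          using 1 2 3 h by (intro norm_triangle_le add_mono) (auto simp: norm_minus_commute)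
        finally have "h * a \<le> h * (a / 4 + (2 + norm (?C X)) * h)"
          by (simp add: h(2) algebra_simps)
        then have "a \<le> a / 4 + (2 + norm (?C X)) * h"
          using mult_le_cancel_left_pos[OF h(1)] by blast
        moreover have "(2 + norm (?C X)) * h < a / 4" using elim unfolding h_def by blast
        ultimately show False using \<open>a / 4 > 0\<close> by linarith
      qed
      then show False by simp
    qed
    \<comment> \<open>Now \<open>G0\<close> inherits the differentiability of \<open>A\<close>,
      which makes the second order expansion available for the competing equation.\<close>
    then have GA: "G0 = A" by blast
    have "G1 X = B X" for X
    proof (rule ccontr)
      define b where "b = norm (G1 X - B X)"
      assume "G1 X \<noteq> B X"
      then have b: "b / 4 > 0" by (simp add: b_def)
      let ?E = "\<lambda>s. X + sqrt s *\<^sub>R A X + s *\<^sub>R (G1 X + (1/2) *\<^sub>R L X (A X))"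
      have "(\<lambda>s. norm (Y X s (sqrt s) - ?E s)) \<in> o[at_right 0](\<lambda>s. s)"
        using solution_expansion_second_order[OF A G(2) Y[of X, unfolded GA] L] .
      \<comment> \<open>Three errors of size \<open>b / 4 * s\<close> cannot add up to
        \<open>b * s\<close>.\<close>
      from eventually_pos_at_right small[OF this b] small[OF close[of X] b] small[OF \<Phi>[of X] b]
      have "\<forall>\<^sub>F s::real in at_right 0. False"
      proof eventually_elim
        case (elim s)
        let ?h = "sqrt s"
        have "s * b = norm (s *\<^sub>R (G1 X - B X))" using elim by (simp add: b_def)
        also have "s *\<^sub>R (G1 X - B X) = - (Y X s ?h - ?E s) + (Y X s ?h - \<Phi> X ?h)
            + (\<Phi> X ?h - (X + ?h *\<^sub>R A X + s *\<^sub>R ?C X))"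
          by (simp add: algebra_simps)
        also have "norm \<dots> \<le> b / 4 * s + b / 4 * s + b / 4 * s"
          using elim by (intro norm_triangle_le add_mono) (simp_all add: norm_minus_commute)
        finally show False using elim b by (simp add: field_simps)
      qed
      then show False by simp
    qed
    then show ?thesis using GA by blast
  qed
  ultimately show ?thesis unfolding the_sqrt_resolution_ode_def by blast
qed

section \<open>The heavy-ball method\<close>

theorem corollary3p1:
  fixes F :: "real ^ 'n \<Rightarrow> real" and \<mu> :: real
  assumes "\<mu> > 0"
    and "C2 F"
    and "strongly_convex \<mu> F"
  shows "the_sqrt_resolution_ode (hb_template \<mu> F)
     (\<lambda>(x, v). (v, - (2 * sqrt \<mu>) *\<^sub>R v - grad F x))
     (\<lambda>(x, v). (1 / 2) *\<^sub>R
        (- (2 * sqrt \<mu>) *\<^sub>R v - grad F x,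
         - (2 * \<mu>) *\<^sub>R v + hessian F x *v v - (2 * sqrt \<mu>) *\<^sub>R grad F x))"
    (is "the_sqrt_resolution_ode _ ?A ?B")
proof -
  \<comment> \<open>This is the derivative of the leading field at \<open>X\<close>, acting on a
    direction \<open>(a, b)\<close>.\<close>
  define L where "L X = (\<lambda>(a :: real ^ 'n, b :: real ^ 'n).
      (b, - (2 * sqrt \<mu>) *\<^sub>R b - hessian F (fst X) *v a))" for X :: "(real ^ 'n) \<times> (real ^ 'n)"
  have grad: "(grad F has_derivative (\<lambda>a. hessian F x *v a)) (at x)" for x
    using \<open>C2 F\<close> jacobian_works unfolding C2_def hessian_def by blast
  then have cgrad: "continuous_on UNIV (grad F)"
    using has_derivative_continuous continuous_at_imp_continuous_on by blast
  have chess: "continuous_on UNIV (hessian F)" using \<open>C2 F\<close> by (simp add: C2_def)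
  show ?thesis
  proof (rule the_sqrt_resolution_ode_of_expansion)
    show "hb_template \<mu> F X 0 = X" for X
      by (cases X) (simp add: hb_template_def polyak_beta_def)
  next
    fix X :: "(real ^ 'n) \<times> (real ^ 'n)"
    obtain x v where X: "X = (x, v)" by (cases X)
    \<comment> \<open>In the second component of \<open>?B X + (1/2) L X (?A X)\<close> the Hessian
      terms and the \<open>sqrt \<mu>\<close> multiples of the gradient cancel, leaving
      \<open>\<mu> v\<close>, the quadratic term of \<open>polyak_beta \<mu> h\<close> times
      \<open>v\<close>. That component of the template is quadratic in \<open>h\<close>, hence
      matched exactly; the extra factor \<open>h\<close> in the position component leaves only a
      cubic term.\<close>
    have eq: "norm (hb_template \<mu> F X (sqrt s) -
        (X + sqrt s *\<^sub>R ?A X + s *\<^sub>R (?B X + (1/2) *\<^sub>R L X (?A X)))) = \<mu> * norm v * (s * sqrt s)"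
      if "s > 0" for s
    proof -
      define h where "h = sqrt s"
      define m where "m = sqrt \<mu>"
      have h: "h > 0" "s = h * h" and m: "m > 0" "\<mu> = m * m"
        using that \<open>\<mu> > 0\<close> by (auto simp: h_def m_def)
      have "hb_template \<mu> F X h - (X + h *\<^sub>R ?A X + s *\<^sub>R (?B X + (1/2) *\<^sub>R L X (?A X)))
          = ((\<mu> * h * s) *\<^sub>R v, 0)"
        unfolding X hb_template_def polyak_beta_def L_def
        \<comment> \<open>Writing \<open>\<mu> = m * m\<close> and \<open>s = h * h\<close> turns
          the claim into an identity polynomial in \<open>m\<close> and \<open>h\<close>.\<close>
        unfolding m_def[symmetric] m(2) h(2)
        by (simp add: vec_eq_iff power2_eq_square field_simps)
      then show ?thesis
        using h m by (simp add: norm_Pair flip: h_def)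
    qed
    show "(\<lambda>s. norm (hb_template \<mu> F X (sqrt s) -
        (X + sqrt s *\<^sub>R ?A X + s *\<^sub>R (?B X + (1/2) *\<^sub>R L X (?A X))))) \<in> o[at_right 0](\<lambda>s. s)"
    proof (rule landau_o.smallI)
      fix c :: real assume "c > 0"
      from eventually_sqrt_less[OF this, of "\<mu> * norm v"] eventually_pos_at_right
      show "\<forall>\<^sub>F s in at_right 0. norm (norm (hb_template \<mu> F X (sqrt s) -
          (X + sqrt s *\<^sub>R ?A X + s *\<^sub>R (?B X + (1/2) *\<^sub>R L X (?A X))))) \<le> c * norm s"
      proof eventually_elim
        case (elim s)
        then show ?case unfolding eq[OF elim(2)] using \<open>\<mu> > 0\<close>
          by (simp add: abs_mult mult_ac)
      qed
    qed
  next
    show "(?A has_derivative L X) (at X)" for X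
      unfolding L_def case_prod_unfold
      by (auto intro!: derivative_eq_intros has_derivative_compose[OF has_derivative_fst grad])
  next
    show "continuous_on UNIV ?B"
      \<comment> \<open>Expanding the matrix product into sums reduces continuity to that of the
        entries of the Hessian.\<close>
      unfolding case_prod_unfold matrix_vector_mult_def
      by (intro continuous_intros continuous_on_compose2[OF cgrad] continuous_on_compose2[OF chess]) auto
  qed
qed

end
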